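(* Let $M\leq N$ be positive integers and let $k$ be a positive integer. Then an array of type $I_k(2^M,2^N,2,3)$ exists if and only if $3\leq k\leq M+N$, $3\leq M$, $k\leq 2^{M-1}$ and $(k,M,N)\notin\{(4,3,3),(8,4,4)\}$.
   Context: For an integer $s\ge 1$ let $[s]=\{0,1,\dots,s-1\}$. An orthogonal array OA$(n,k,q,t)$ (size $n$, degree $k$, $q$ levels, strength $t$, $1\le t\leq k$) is an $n\times k$ array with entries from $[q]$ such that in every $n\times t$ submatrix (choice of $t$ columns), every vector of $[q]^t$ appears as a row exactly $n/q^t$ times. An array of type $I_k(m,n,q,t)$ (an $m\times n$ row-column factorial design $q^k$ of strength $t$; it presupposes $t\le k$) is an $m\times n$ array whose cells each contain a vector of $[q]^k$ such that: (i) each vector of $[q]^k$ occurs in exactly $\lambda=mn/q^k$ cells (so $q^k\mid mn$); (ii) for each row of the array, the $n$ vectors in that row are the rows of an OA$(n,k,q,t)$; (iii) for each column of the array, the $m$ vectors in that column are the rows of an OA$(m,k,q,t)$. *)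

theory Defs
  imports Main "HOL-Library.FuncSet"
begin

text \<open>
  The vectors over \<open>[q] = {0, \<dots>, q - 1}\<close> with coordinates indexed by \<open>S\<close>;
  \<open>[q]\<^sup>k\<close> is \<open>vectors {..<k} q\<close>.  They are extensional functions, so
  equality of vectors is equality of functions.
\<close>
definition vectors :: "nat set \<Rightarrow> nat \<Rightarrow> (nat \<Rightarrow> nat) set" where
  "vectors S q = S \<rightarrow>\<^sub>E {..<q}"

text \<open>
  \<open>A i\<close>, for \<open>i < n\<close>, is the \<open>i\<close>-th row of the array; only these values of \<open>A\<close> matter.
  A choice of \<open>t\<close> columns is a set \<open>S\<close> of \<open>t\<close> column indices.
  That a vector occurs \<open>n / q\<^sup>t\<close> times is written without division; this also
  forces \<open>q\<^sup>t dvd n\<close>.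
\<close>
definition orthogonal_array ::
  "nat \<Rightarrow> nat \<Rightarrow> nat \<Rightarrow> nat \<Rightarrow> (nat \<Rightarrow> nat \<Rightarrow> nat) \<Rightarrow> bool" where
  "orthogonal_array n k q t A \<longleftrightarrow>
     1 \<le> q \<and> 1 \<le> t \<and> t \<le> k \<and>
     (\<forall>i<n. A i \<in> vectors {..<k} q) \<and>
     (\<forall>S. S \<subseteq> {..<k} \<and> card S = t \<longrightarrow>
        (\<forall>v \<in> vectors S q. card {i. i < n \<and> restrict (A i) S = v} * q ^ t = n))"

text \<open>
  \<open>F i j\<close>, for \<open>i < m\<close> and \<open>j < n\<close>, is the vector in the cell in row \<open>i\<close> and column \<open>j\<close>.
\<close>
definition row_column_design ::
  "nat \<Rightarrow> nat \<Rightarrow> nat \<Rightarrow> nat \<Rightarrow> nat \<Rightarrow> (nat \<Rightarrow> nat \<Rightarrow> nat \<Rightarrow> nat) \<Rightarrow> bool" where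
  "row_column_design k m n q t F \<longleftrightarrow>
     1 \<le> q \<and> 1 \<le> t \<and> t \<le> k \<and>
     (\<forall>i<m. \<forall>j<n. F i j \<in> vectors {..<k} q) \<and>
     (\<forall>v \<in> vectors {..<k} q. card {(i, j). i < m \<and> j < n \<and> F i j = v} * q ^ k = m * n) \<and>
     (\<forall>i<m. orthogonal_array n k q t (\<lambda>j. F i j)) \<and>
     (\<forall>j<n. orthogonal_array m k q t (\<lambda>i. F i j))"

end

theory Submission
  imports Defs
begin

text \<open>
  Write the entries additively in \<open>F\<^sub>2\<close>.  For existence take \<open>F i j c = \<langle>a c, i\<rangle> + \<langle>b c, j\<rangle>\<close> with
  \<open>a c \<in> F\<^sub>2\<^sup>M\<close>, \<open>b c \<in> F\<^sub>2\<^sup>N\<close>: the rows and columns have strength 3 iff any three of the \<open>b c\<close>, and any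
  three of the \<open>a c\<close>, are linearly independent, and the design is balanced iff the \<open>k\<close> pairs
  \<open>(a c, b c)\<close> are independent.  Keeping all \<open>a c\<close> in the affine hyperplane of odd numbers, such a
  system extends from \<open>(M, N, k)\<close> to \<open>(M, N + 1, k + 1)\<close> as long as \<open>k < 2\<^sup>M\<^sup>-\<^sup>1\<close>, and from \<open>(M, M, k)\<close>
  to \<open>(M + 1, M + 1, k + 2)\<close>; this leaves the three cases \<open>(3, 3, 3)\<close>, \<open>(4, 4, 7)\<close>, \<open>(5, 5, 10)\<close>.

  For necessity, \<open>k \<le> 2\<^sup>M\<^sup>-\<^sup>1\<close> is Rao's bound \<open>2 k \<le> n\<close> for strength 3.  If it is attained with \<open>4 dvd k\<close>,
  two distinct rows of the orthogonal array differ in \<open>k\<close> or \<open>k / 2\<close> places, so all its rows have the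
  same parity.  In the two exceptional cases this applies to every row and every column of the
  design, which then has vectors of one parity only.
\<close>

section \<open>Characters of F_2^S and uniform distribution\<close>

lemma minus_one_power_cases: "(- 1 :: int) ^ n = 1 \<or> (- 1 :: int) ^ n = - 1"
  by (cases "even n") auto

lemma minus_one_power_square: "(- 1 :: int) ^ n * (- 1) ^ n = 1"
  by (simp flip: power_add)

text \<open>The sum factors over the coordinates, and the factor at any \<open>c\<close> in
  \<open>T\<close> is 1 + (-1) = 0.\<close>

lemma sum_minus_one_power_vectors:
  assumes "finite S" "T \<subseteq> S" "T \<noteq> {}"
  shows "(\<Sum>v\<in>vectors S 2. (- 1 :: int) ^ (\<Sum>c\<in>T. v c)) = 0"
proof -
  have "finite T" using assms finite_subset by blast
  have "(\<Sum>v\<in>vectors S 2. (- 1 :: int) ^ (\<Sum>c\<in>T. v c)) =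
      (\<Sum>v\<in>vectors S 2. \<Prod>c\<in>S. if c \<in> T then (- 1) ^ v c else 1)"
    using assms by (simp add: power_sum prod.inter_restrict[symmetric] Int_absorb1)
  also have "\<dots> = (\<Prod>c\<in>S. \<Sum>x\<in>{..<2::nat}. if c \<in> T then (- 1) ^ x else 1)"
    unfolding vectors_def using assms(1) by (subst prod_sum_PiE) auto
  also have "\<dots> = 0"
    using assms by (force simp: numeral_2_eq_2 intro!: prod_zero)
  finally show ?thesis .
qed

lemma restrict_in_vectors: "h \<in> vectors K q \<Longrightarrow> S \<subseteq> K \<Longrightarrow> restrict h S \<in> vectors S q"
  unfolding vectors_def by auto

lemma finite_vectors: "finite S \<Longrightarrow> finite (vectors S q)"
  unfolding vectors_def by (simp add: finite_PiE)

lemma character_sum_if_uniform: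
  assumes "finite X" "finite S" "T \<subseteq> S" "T \<noteq> {}"
    and h: "\<And>x. x \<in> X \<Longrightarrow> restrict (h x) S \<in> vectors S 2"
    and unif: "\<And>v. v \<in> vectors S 2 \<Longrightarrow> card {x \<in> X. restrict (h x) S = v} * 2 ^ card S = card X"
  shows "(\<Sum>x\<in>X. (- 1 :: int) ^ (\<Sum>c\<in>T. h x c)) = 0"
proof -
  let ?g = "\<lambda>v. (- 1 :: int) ^ (\<Sum>c\<in>T. v c)"
  have "(\<Sum>x\<in>X. ?g (h x)) = (\<Sum>x\<in>X. ?g (restrict (h x) S))"
    using assms(3) by (intro sum.cong refl arg_cong[where f = "(^) _"]) (auto intro!: sum.cong)
  also have "\<dots> = (\<Sum>v\<in>vectors S 2. \<Sum>x\<in>{x \<in> X. restrict (h x) S = v}. ?g (restrict (h x) S))"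
    using assms(1,2) h by (intro sum.group[symmetric]) (auto simp: finite_vectors)
  also have "\<dots> = (\<Sum>v\<in>vectors S 2. int (card {x \<in> X. restrict (h x) S = v}) * ?g v)"
    by (intro sum.cong refl) simp
  finally have "(\<Sum>x\<in>X. ?g (h x)) * 2 ^ card S =
      (\<Sum>v\<in>vectors S 2. int (card {x \<in> X. restrict (h x) S = v} * 2 ^ card S) * ?g v)"
    by (simp add: sum_distrib_left mult_ac)
  also have "\<dots> = (\<Sum>v\<in>vectors S 2. int (card X) * ?g v)"
    using unif by (intro sum.cong refl) simp
  also have "\<dots> = 0"
    using sum_minus_one_power_vectors[OF assms(2-4)] by (simp flip: sum_distrib_left)
  finally show ?thesis by simp
qed

text \<open>Fourier inversion: the product over \<open>S\<close> of the factors
  \<open>(- 1) ^ (h x c + v c) + 1\<close> is \<open>2 ^ card S\<close> times the indicator of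
  \<open>restrict (h x) S = v\<close>. Expanding it over the subsets \<open>T\<close> of
  \<open>S\<close> and summing over \<open>X\<close>, only \<open>T = {}\<close> survives.\<close>

lemma uniform_if_character_sums:
  assumes "finite X" "finite S"
    and h: "\<And>x. x \<in> X \<Longrightarrow> restrict (h x) S \<in> vectors S 2"
    and char: "\<And>T. T \<subseteq> S \<Longrightarrow> T \<noteq> {} \<Longrightarrow> (\<Sum>x\<in>X. (- 1 :: int) ^ (\<Sum>c\<in>T. h x c)) = 0"
    and v: "v \<in> vectors S 2"
  shows "card {x \<in> X. restrict (h x) S = v} * 2 ^ card S = card X"
proof -
  have factor: "(\<Prod>c\<in>S. (- 1 :: int) ^ (h x c + v c) + 1) = (if restrict (h x) S = v then 2 ^ card S else 0)"
    if "x \<in> X" for x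
  proof (cases "restrict (h x) S = v")
    case True
    then have "h x c = v c" if "c \<in> S" for c using that by auto
    then show ?thesis using True by simp
  next
    case False
    then obtain c where c: "c \<in> S" "h x c \<noteq> v c"
      using v unfolding vectors_def by (metis PiE_ext restrict_PiE restrict_apply' restrict_ext PiE_restrict)
    have "h x c < 2" "v c < 2"
      using h[OF that] v c(1) unfolding vectors_def by (auto dest!: PiE_mem)
    then have "h x c + v c = 1" using c(2) by linarith
    then have "(- 1 :: int) ^ (h x c + v c) + 1 = 0" by simp
    then have "(\<Prod>c\<in>S. (- 1 :: int) ^ (h x c + v c) + 1) = 0"
      using c(1) assms(2) by (intro prod_zero) blast+
    then show ?thesis using False by simp
  qed
  have "int (card {x \<in> X. restrict (h x) S = v} * 2 ^ card S) =
      (\<Sum>x\<in>X. if restrict (h x) S = v then 2 ^ card S else 0)"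
    using assms(1) by (simp add: sum.If_cases Int_def)
  also have "\<dots> = (\<Sum>x\<in>X. \<Prod>c\<in>S. (- 1 :: int) ^ (h x c + v c) + 1)"
    using factor by (intro sum.cong) auto
  also have "\<dots> = (\<Sum>x\<in>X. \<Sum>T\<in>Pow S. \<Prod>c\<in>T. (- 1 :: int) ^ (h x c + v c))"
    using assms(2) by (simp add: prod_add)
  also have "\<dots> = (\<Sum>T\<in>Pow S. (\<Prod>c\<in>T. (- 1 :: int) ^ v c) * (\<Sum>x\<in>X. (- 1) ^ (\<Sum>c\<in>T. h x c)))"
    by (subst sum.swap) (simp add: power_add prod.distrib sum_distrib_left power_sum mult.commute)
  also have "\<dots> = (\<Sum>T\<in>Pow S. if T = {} then int (card X) else 0)"
    using char by (intro sum.cong) auto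
  also have "\<dots> = int (card X)"
    using assms(2) by simp
  finally show ?thesis by (simp only: of_nat_eq_iff)
qed

section \<open>Rao's bound for strength 3 and its equality case\<close>

lemma orthogonal_array_column_sums:
  assumes oa: "orthogonal_array n k 2 3 A" and T: "T \<subseteq> {..<k}" "T \<noteq> {}" "card T \<le> 3"
  shows "(\<Sum>r<n. (- 1 :: int) ^ (\<Sum>c\<in>T. A r c)) = 0"
proof -
  have k: "3 \<le> k" using oa by (simp add: orthogonal_array_def)
  \<comment> \<open>The definition speaks only of sets of exactly three columns, so a smaller
    \<open>T\<close> is completed to such a set.\<close>
  obtain S where S: "T \<subseteq> S" "S \<subseteq> {..<k}" "card S = 3"
    using exists_subset_between[OF T(3) _ T(1)] k by auto
  then have "finite S" using finite_subset by blast
  show ?thesis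
  proof (rule character_sum_if_uniform[OF _ \<open>finite S\<close> S(1) T(2)])
    show "restrict (A r) S \<in> vectors S 2" if "r \<in> {..<n}" for r
      using oa that S(2) by (auto simp: orthogonal_array_def intro: restrict_in_vectors)
    show "card {r \<in> {..<n}. restrict (A r) S = v} * 2 ^ card S = card {..<n}" if "v \<in> vectors S 2" for v
      using oa that S by (simp add: orthogonal_array_def)
  qed simp
qed

text \<open>
  \<open>K\<close> is the kernel of the \<open>2 * k\<close> pairwise orthogonal columns \<open>u\<^sub>c\<close> and \<open>u\<^sub>e * u\<^sub>c\<close>,
  hence \<open>n\<close> times an orthogonal projection, and its row norms are \<open>n\<close> times its diagonal entries.
\<close>
lemma rao_kernel:
  fixes A :: "nat \<Rightarrow> nat \<Rightarrow> nat" and k :: nat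
  defines "u \<equiv> \<lambda>r c. (- 1 :: int) ^ A r c"
  defines "K \<equiv> \<lambda>e r s. (\<Sum>c<k. u r c * u s c) * (1 + u r e * u s e)"
  assumes oa: "orthogonal_array n k 2 3 A" and e: "e < k"
  shows "(\<Sum>s<n. (K e r s)\<^sup>2) = 2 * int k * int n" and "K e r r = 2 * int k"
proof -
  have sq: "u r c * u r c = 1" for r c
    unfolding u_def by (rule minus_one_power_square)
  have one: "(\<Sum>s<n. u s c) = 0" if "c < k" for c
    using orthogonal_array_column_sums[OF oa, of "{c}"] that by (simp add: u_def)
  have two: "(\<Sum>s<n. u s c * u s d) = (if c = d then int n else 0)" if "c < k" "d < k" for c d
  proof (cases "c = d")
    case False
    then show ?thesis
      using orthogonal_array_column_sums[OF oa, of "{c, d}"] that by (simp add: u_def power_add)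
  qed (simp add: sq)
  \<comment> \<open>Coinciding columns cancel because the entries are signs, so every case reduces
    to a single column or to three distinct ones.\<close>
  have three: "(\<Sum>s<n. u s e * (u s c * u s d)) = 0" if "c < k" "d < k" for c d
  proof -
    consider "c = d" | "c \<noteq> d" "c = e" | "c \<noteq> d" "d = e" | "c \<noteq> d" "c \<noteq> e" "d \<noteq> e" by blast
    then show ?thesis
    proof cases
      case 1
      then show ?thesis using one[OF e] by (simp add: sq)
    next
      case 2
      then show ?thesis using one[OF \<open>d < k\<close>] by (simp add: sq flip: mult.assoc)
    next
      case 3
      then have eq: "u s e * (u s c * u s d) = u s c" for s
        using sq[of s e] by (simp add: mult.left_commute)
      show ?thesis using one[OF \<open>c < k\<close>] by (simp only: eq)
    next
      case 4
      then show ?thesis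
        using orthogonal_array_column_sums[OF oa, of "{e, c, d}"] that e by (simp add: u_def power_add)
    qed
  qed
  show "K e r r = 2 * int k" by (simp add: K_def sq)
  have expand: "(K e r s)\<^sup>2 = 2 * (\<Sum>c<k. \<Sum>d<k. u r c * u r d * (u s c * u s d))
      + 2 * u r e * (\<Sum>c<k. \<Sum>d<k. u r c * u r d * (u s e * (u s c * u s d)))" for s
  proof -
    \<comment> \<open>The factor is 0 or 2, so its square is twice itself; only products of two or
      three columns remain.\<close>
    have w: "(1 + u r e * u s e)\<^sup>2 = 2 + 2 * (u r e * u s e)"
      using sq[of r e] sq[of s e] by (simp add: power2_eq_square algebra_simps)
    have "(\<Sum>c<k. u r c * u s c)\<^sup>2 = (\<Sum>c<k. \<Sum>d<k. u r c * u r d * (u s c * u s d))"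
      by (simp add: power2_eq_square sum_product mult_ac)
    moreover have "(\<Sum>c<k. \<Sum>d<k. u r c * u r d * (u s e * (u s c * u s d))) =
        u s e * (\<Sum>c<k. \<Sum>d<k. u r c * u r d * (u s c * u s d))"
      by (simp add: sum_distrib_left mult_ac)
    ultimately show ?thesis
      unfolding K_def power_mult_distrib w by (simp add: algebra_simps)
  qed
  have swap: "(\<Sum>s<n. \<Sum>c<k. \<Sum>d<k. u r c * u r d * f s c d) = (\<Sum>c<k. \<Sum>d<k. u r c * u r d * (\<Sum>s<n. f s c d))"
    for f :: "nat \<Rightarrow> nat \<Rightarrow> nat \<Rightarrow> int"
  proof -
    have "(\<Sum>s<n. \<Sum>c<k. \<Sum>d<k. u r c * u r d * f s c d) = (\<Sum>c<k. \<Sum>s<n. \<Sum>d<k. u r c * u r d * f s c d)"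
      by (rule sum.swap)
    also have "\<dots> = (\<Sum>c<k. \<Sum>d<k. \<Sum>s<n. u r c * u r d * f s c d)"
      by (intro sum.cong refl sum.swap)
    finally show ?thesis by (simp add: sum_distrib_left)
  qed
  have "(\<Sum>s<n. (K e r s)\<^sup>2) = 2 * (\<Sum>c<k. \<Sum>d<k. u r c * u r d * (\<Sum>s<n. u s c * u s d))
      + 2 * u r e * (\<Sum>c<k. \<Sum>d<k. u r c * u r d * (\<Sum>s<n. u s e * (u s c * u s d)))"
    unfolding expand sum.distrib swap[symmetric] by (simp add: sum_distrib_left)
  also have "\<dots> = 2 * (\<Sum>c<k. \<Sum>d<k. if c = d then int n else 0)"
    by (simp add: two three sq if_distrib cong: if_cong)
  also have "\<dots> = 2 * int k * int n"
    by simp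
  finally show "(\<Sum>s<n. (K e r s)\<^sup>2) = 2 * int k * int n" .
qed

text \<open>The diagonal term of the kernel's row norm alone gives
  \<open>(2 * k)\<^sup>2 \<le> 2 * k * n\<close>.\<close>

lemma rao_bound:
  assumes oa: "orthogonal_array n k 2 3 A" and "0 < n"
  shows "2 * k \<le> n"
proof -
  have k: "0 < k" using oa by (simp add: orthogonal_array_def)
  let ?K = "\<lambda>s. (\<Sum>c<k. (- 1 :: int) ^ A 0 c * (- 1) ^ A s c) * (1 + (- 1) ^ A 0 0 * (- 1) ^ A s 0)"
  have "(?K 0)\<^sup>2 \<le> (\<Sum>s<n. (?K s)\<^sup>2)"
    using assms(2) by (intro member_le_sum) auto
  then have "(2 * int k) * (2 * int k) \<le> 2 * int k * int n"
    using rao_kernel[OF oa k, of 0] by (simp only: power2_eq_square)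
  then show ?thesis using k by simp
qed

text \<open>\<open>d\<close> is the number of minus signs. For the entrywise product of two rows it
  counts the places where they differ, which links their relative parity to their inner
  product.\<close>

lemma prod_sum_signs:
  assumes "finite S" "\<And>c. c \<in> S \<Longrightarrow> p c = 1 \<or> p c = (- 1 :: int)"
  shows "\<exists>d\<le>card S. prod p S = (- 1) ^ d \<and> sum p S = int (card S) - 2 * int d"
  using assms
proof (induction S)
  case (insert c S)
  then obtain d where d: "d \<le> card S" "prod p S = (- 1) ^ d" "sum p S = int (card S) - 2 * int d" by auto
  have "p c = 1 \<or> p c = - 1" using insert by simp
  then show ?case
  proof
    assume "p c = 1"
    then show ?thesis using insert(1,2) d by (intro exI[of _ d]) auto
  next
    assume "p c = - 1"
    then show ?thesis using insert(1,2) d by (intro exI[of _ "Suc d"]) auto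
  qed
qed simp

text \<open>In the tight case the diagonal entry exhausts its row norm in the kernel of
  \<open>rao_kernel\<close>, so the entry at \<open>(r, s)\<close> is 0. If the rows agree at
  \<open>e\<close>, this forces their inner product \<open>k - 2 * d\<close> to vanish, and
  \<open>d\<close> is half of \<open>k\<close>, hence even. If they agree nowhere, \<open>d\<close>
  has the parity of \<open>k\<close>.\<close>

lemma constant_parity_if_rao_tight:
  assumes oa: "orthogonal_array n k 2 3 A" and "n = 2 * k" "4 dvd k" and rs: "r < n" "s < n"
  shows "(- 1 :: int) ^ (\<Sum>c<k. A r c) = (- 1) ^ (\<Sum>c<k. A s c)"
proof (cases "r = s")
  case False
  let ?p = "\<lambda>c. (- 1 :: int) ^ A r c * (- 1) ^ A s c"
  have p: "?p c = 1 \<or> ?p c = - 1" for c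
    by (metis minus_one_power_cases power_add)
  obtain d where d: "prod ?p {..<k} = (- 1) ^ d" "sum ?p {..<k} = int k - 2 * int d"
    using prod_sum_signs[of "{..<k}" ?p] p by auto
  have "even d"
  proof (cases "\<exists>e<k. ?p e = 1")
    case True
    then obtain e where e: "e < k" "?p e = 1" by blast
    let ?K = "\<lambda>s. (\<Sum>c<k. (- 1 :: int) ^ A r c * (- 1) ^ A s c) * (1 + (- 1) ^ A r e * (- 1) ^ A s e)"
    have "(\<Sum>s<n. (?K s)\<^sup>2) = (\<Sum>s\<in>{r}. (?K s)\<^sup>2)"
      using rao_kernel[OF oa e(1), of r] assms(2) by (simp add: power2_eq_square)
    moreover have "(\<Sum>s\<in>{r, s}. (?K s)\<^sup>2) \<le> (\<Sum>s<n. (?K s)\<^sup>2)"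
      using rs by (intro sum_mono2) auto
    ultimately have "(?K s)\<^sup>2 \<le> 0" using False by simp
    then have "?K s = 0" by simp
    then have "sum ?p {..<k} = 0" using e(2) by simp
    then have "k = 2 * d" using d(2) by linarith
    then show ?thesis using assms(3) by auto
  next
    case False
    then have "?p c = - 1" if "c < k" for c using p that by blast
    then have "prod ?p {..<k} = (- 1) ^ k" by simp
    moreover have "even k" using assms(3) by auto
    ultimately have "(- 1 :: int) ^ d = 1" using d(1) by simp
    then show ?thesis by (metis neg_one_odd_power one_neq_neg_one)
  qed
  then have "(- 1 :: int) ^ (\<Sum>c<k. A r c) * (- 1) ^ (\<Sum>c<k. A s c) = 1"
    using d(1) by (simp add: prod.distrib power_sum)
  then show ?thesis
    using minus_one_power_cases[of "\<Sum>c<k. A r c"] minus_one_power_cases[of "\<Sum>c<k. A s c"] by auto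
qed simp

section \<open>Independent systems of paired vectors over F_2, with the three base cases\<close>

abbreviation xor_nat (infixl "\<oplus>" 65) where "x \<oplus> y \<equiv> semiring_bit_operations_class.xor x (y::nat)"

text \<open>For finite \<open>T\<close> this is bit \<open>n\<close> of the XOR of all
  \<open>a c\<close> with \<open>c\<close> in \<open>T\<close>; a nonempty \<open>T\<close> with no
  such bit is a linear dependence.\<close>

definition odd_at :: "(nat \<Rightarrow> nat) \<Rightarrow> nat set \<Rightarrow> nat \<Rightarrow> bool" where
  "odd_at a T n \<longleftrightarrow> odd (card {c \<in> T. bit (a c) n})"

text \<open>The case \<open>x = y\<close> excludes 0, so any three distinct members of
  \<open>B\<close> are linearly independent.\<close>

definition sum_free :: "nat set \<Rightarrow> bool" where
  "sum_free B \<longleftrightarrow> (\<forall>x\<in>B. \<forall>y\<in>B. x \<oplus> y \<notin> B)"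

text \<open>Oddness makes the image of \<open>a\<close> sum-free by itself. The \<open>b c\<close>
  are not tied to an affine hyperplane missing 0 as well: then all pairs would lie in one linear
  hyperplane, and \<open>k = M + N\<close> would be out of reach.\<close>

definition paired_caps :: "nat \<Rightarrow> nat \<Rightarrow> nat \<Rightarrow> (nat \<Rightarrow> nat) \<Rightarrow> (nat \<Rightarrow> nat) \<Rightarrow> bool" where
  "paired_caps M N k a b \<longleftrightarrow>
     (\<forall>c<k. odd (a c) \<and> a c < 2 ^ M \<and> b c < 2 ^ N) \<and>
     inj_on a {..<k} \<and> inj_on b {..<k} \<and> sum_free (b ` {..<k}) \<and>
     (\<forall>T\<subseteq>{..<k}. T \<noteq> {} \<longrightarrow> (\<exists>n. odd_at a T n \<or> odd_at b T n))"

lemma paired_capsD: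
  assumes "paired_caps M N k a b"
  shows "c < k \<Longrightarrow> odd (a c)" "c < k \<Longrightarrow> a c < 2 ^ M" "c < k \<Longrightarrow> b c < 2 ^ N"
    and "inj_on a {..<k}" "inj_on b {..<k}" "sum_free (b ` {..<k})"
    and "T \<subseteq> {..<k} \<Longrightarrow> T \<noteq> {} \<Longrightarrow> \<exists>n. odd_at a T n \<or> odd_at b T n"
  using assms unfolding paired_caps_def by blast+

text \<open>The length is the unreduced dot product of \<open>a d\<close> with the vector given by
  the positions in \<open>ns\<close>; each position contributes an even number to the sum over
  \<open>T\<close>.\<close>

lemma even_sum_length_filter:
  assumes "\<forall>n\<in>set ns. \<not> odd_at a T n"
  shows "even (\<Sum>d\<in>T. length (filter (bit (a d)) ns))"
proof (cases "finite T")
  case True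
  from assms show ?thesis
  proof (induction ns)
    case (Cons n ns)
    have "card {d \<in> T. bit (a d) n} = (\<Sum>d\<in>T. of_bool (bit (a d) n))"
      using True by (simp add: Int_def)
    then have "(\<Sum>d\<in>T. length (filter (bit (a d)) (n # ns))) =
        card {d \<in> T. bit (a d) n} + (\<Sum>d\<in>T. length (filter (bit (a d)) ns))"
      by (simp only: flip: sum.distrib) (rule sum.cong, auto)
    then show ?case using Cons by (simp add: odd_at_def)
  qed simp
qed simp

text \<open>
  \<open>V ! c\<close> and \<open>W ! c\<close> list the bit positions of the \<open>c\<close>-th member of a dual system to the pairs
  \<open>(A ! d, B ! d)\<close>, which certifies their independence.
\<close>
lemma paired_caps_nth:
  assumes len: "length A = k" "length B = k" and dist: "distinct A" "distinct B"
    and bds: "\<forall>x\<in>set A. odd x \<and> x < 2 ^ M" "\<forall>y\<in>set B. y < 2 ^ N" "sum_free (set B)"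
    and dual: "\<forall>c<k. \<forall>d<k.
      odd (length (filter (bit (A ! d)) (V ! c)) + length (filter (bit (B ! d)) (W ! c))) \<longleftrightarrow> d = c"
  shows "paired_caps M N k (nth A) (nth B)"
proof -
  have "nth B ` {..<k} = set B"
    using len(2) by (auto simp: in_set_conv_nth)
  moreover have "inj_on (nth A) {..<k}" "inj_on (nth B) {..<k}"
    using len dist by (auto intro: inj_on_nth)
  moreover have "\<exists>n. odd_at (nth A) T n \<or> odd_at (nth B) T n" if T: "T \<subseteq> {..<k}" "T \<noteq> {}" for T
  proof (rule ccontr)
    assume "\<nexists>n. odd_at (nth A) T n \<or> odd_at (nth B) T n"
    then have none: "\<not> odd_at (nth A) T n" "\<not> odd_at (nth B) T n" for n
      by blast+
    obtain c where c: "c \<in> T" using T by blast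
    have fin: "finite T" using T(1) finite_subset by blast
    \<comment> \<open>This is the pairing of the \<open>d\<close>-th pair with the
      \<open>c\<close>-th dual vector. A dependence on \<open>T\<close> makes its sum even, whereas
      by duality \<open>d = c\<close> is the only odd term.\<close>
    let ?g = "\<lambda>d. length (filter (bit (A ! d)) (V ! c)) + length (filter (bit (B ! d)) (W ! c))"
    have "even (\<Sum>d\<in>T. ?g d)"
      using even_sum_length_filter[of "V ! c" "nth A" T] even_sum_length_filter[of "W ! c" "nth B" T] none
      by (simp add: sum.distrib)
    moreover have "{d \<in> T. odd (?g d)} = {c}"
      using dual c T by auto
    then have "odd (\<Sum>d\<in>T. ?g d)"
      using even_sum_iff[OF fin, of ?g] by simp
    ultimately show False by blast
  qed
  ultimately show ?thesis
    unfolding paired_caps_def using len bds by (metis nth_mem)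
qed

lemma paired_caps_3: "\<exists>a b. paired_caps 3 3 3 a b"
proof (intro exI)
  show "paired_caps 3 3 3 (nth [1, 3, 5]) (nth [1, 2, 4])"
    by (rule paired_caps_nth[where V = "[[], [], []]" and W = "[[0], [1], [2]]"])
      (simp_all add: sum_free_def, code_simp)
qed

text \<open>Both lists are seven of the eight points of an affine hyperplane missing 0: the odd
  numbers, and the numbers whose bits 0, 2 and 3 have odd sum.\<close>

lemma paired_caps_4: "\<exists>a b. paired_caps 4 4 7 a b"
proof (intro exI)
  show "paired_caps 4 4 7 (nth [1, 3, 5, 7, 9, 11, 13]) (nth [10, 6, 13, 4, 3, 1, 8])"
    by (rule paired_caps_nth[where
          V = "[[0, 3], [0, 1, 3], [0, 1, 2], [2, 3], [1], [0, 2], [1, 2, 3]]" and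
          W = "[[2], [0, 1], [1, 2], [0], [0, 2], [1], [1, 3]]"])
      (simp_all add: sum_free_def, code_simp)
qed

text \<open>The pairs form a basis of F_2^10, so \<open>k\<close> attains \<open>M + N\<close>;
  \<open>V\<close> and \<open>W\<close> spell out the inverse matrix.\<close>

lemma paired_caps_5: "\<exists>a b. paired_caps 5 5 10 a b"
proof (intro exI)
  show "paired_caps 5 5 10 (nth [1, 3, 5, 7, 9, 11, 17, 19, 21, 25])
      (nth [16, 21, 14, 7, 12, 20, 8, 10, 3, 17])"
    by (rule paired_caps_nth[where
          V = "[[0, 4], [1, 3, 4], [0, 2], [2, 3], [0, 1], [4], [1], [2], [0, 2, 3], [0, 1, 3, 4]]" and
          W = "[[2], [1, 3], [3, 4], [0, 2], [1, 2, 3, 4], [0, 2, 3], [2, 3], [1], [0, 2, 3, 4], [0, 1, 4]]"])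
      (simp_all add: sum_free_def, code_simp)
qed

section \<open>Extension steps and existence of paired caps\<close>

lemma sum_freeD: "sum_free B \<Longrightarrow> x \<in> B \<Longrightarrow> y \<in> B \<Longrightarrow> x \<oplus> y \<notin> B"
  unfolding sum_free_def by (drule bspec, assumption, drule bspec, assumption)

lemma sum_free_subset: "sum_free B \<Longrightarrow> A \<subseteq> B \<Longrightarrow> sum_free A"
  unfolding sum_free_def by (intro ballI) (meson subsetD)

lemma paired_caps_mono:
  assumes "paired_caps M N k a b" "N \<le> N'" "k' \<le> k"
  shows "paired_caps M N' k' a b"
proof -
  have sub: "{..<k'} \<subseteq> {..<k}" using assms(3) by auto
  have le: "(2::nat) ^ N \<le> 2 ^ N'" using assms(2) by (simp add: power_increasing)
  have "\<forall>c<k'. odd (a c) \<and> a c < 2 ^ M \<and> b c < 2 ^ N'"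
    using paired_capsD(1-3)[OF assms(1)] le assms(3) by (meson less_le_trans)
  moreover have "inj_on a {..<k'}" "inj_on b {..<k'}"
    using paired_capsD(4,5)[OF assms(1)] sub by (meson inj_on_subset)+
  moreover have "sum_free (b ` {..<k'})"
    using paired_capsD(6)[OF assms(1)] image_mono[OF sub, of b] by (rule sum_free_subset)
  moreover have "\<forall>T\<subseteq>{..<k'}. T \<noteq> {} \<longrightarrow> (\<exists>n. odd_at a T n \<or> odd_at b T n)"
    using paired_capsD(7)[OF assms(1)] sub by (meson subset_trans)
  ultimately show ?thesis unfolding paired_caps_def by blast
qed

lemma odd_at_cong: "(\<And>c. c \<in> T \<Longrightarrow> a c = a' c) \<Longrightarrow> odd_at a T n = odd_at a' T n"
  unfolding odd_at_def by (rule arg_cong[where f = "\<lambda>S. odd (card S)"]) auto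

lemma not_bit_if_less: "(x::nat) < 2 ^ n \<Longrightarrow> \<not> bit x n"
  by (simp add: bit_iff_odd)

lemma odd_at_fresh:
  assumes "T \<subseteq> {..k}" "k \<in> T" "bit (a k) n" "\<And>c. c < k \<Longrightarrow> a c < 2 ^ n"
  shows "odd_at a T n"
proof -
  have "{c \<in> T. bit (a c) n} = {k}"
    using assms not_bit_if_less by (auto simp: order_le_less)
  then show ?thesis by (simp add: odd_at_def)
qed

lemma xor_nat_less: "(x::nat) < 2 ^ n \<Longrightarrow> y < 2 ^ n \<Longrightarrow> x \<oplus> y < 2 ^ n"
  by (metis take_bit_nat_eq_self_iff take_bit_xor)

lemma inj_on_extend: "inj_on f {..<k} \<Longrightarrow> y \<notin> f ` {..<k} \<Longrightarrow> inj_on (f(k := y)) {..<Suc k}"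
  by (auto simp: lessThan_Suc inj_on_fun_updI)

lemma image_extend: "(f(k := y)) ` {..<Suc k} = insert y (f ` {..<k})"
  by (auto simp: lessThan_Suc)

lemma sum_free_insert:
  assumes "sum_free B" "y \<noteq> 0" "y \<notin> B" "\<And>u v. u \<in> B \<Longrightarrow> v \<in> B \<Longrightarrow> u \<oplus> v \<noteq> y"
  shows "sum_free (insert y B)"
proof -
  \<comment> \<open>Every element is its own inverse, so a relation \<open>y \<oplus> u = v\<close>
    turns into \<open>u \<oplus> v = y\<close>.\<close>
  have canc: "u \<oplus> v = w \<Longrightarrow> u \<oplus> w = v" "u \<oplus> v = w \<Longrightarrow> v \<oplus> w = u" "u \<oplus> v = u \<Longrightarrow> v = 0"
    for u v w :: nat
    by (auto simp: bit_eq_iff bit_simps)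
  have zero: "0 \<notin> B" using sum_freeD[OF assms(1), of 0 0] by auto
  have y: "y \<oplus> u \<notin> insert y B" if "u \<in> B" for u
    using that zero assms(4) canc(2,3)[of y u] by (metis insert_iff)
  have "u \<oplus> v \<notin> insert y B" if uv: "u \<in> insert y B" "v \<in> insert y B" for u v
  proof -
    consider "u = y" "v = y" | "u = y" "v \<in> B" | "u \<in> B" "v = y" | "u \<in> B" "v \<in> B"
      using uv by blast
    then show ?thesis
    proof cases
      case 1
      then show ?thesis using zero assms(2) by simp
    next
      case 2
      then show ?thesis using y by simp
    next
      case 3
      then show ?thesis using y by (simp add: xor.commute)
    next
      case 4
      then show ?thesis using assms(4)[of u v] sum_freeD[OF assms(1)] by simp
    qed
  qed
  then show ?thesis unfolding sum_free_def by simp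
qed

text \<open>A set \<open>T\<close> containing the new index is detected at the fresh bit, which no
  older vector has; any other \<open>T\<close> is handled by the old system.\<close>

lemma paired_caps_extend:
  assumes pc: "paired_caps M N k a b" and "M \<le> M'" "N \<le> N'"
    and x: "odd x" "x < 2 ^ M'" "x \<notin> a ` {..<k}"
    and y: "y < 2 ^ N'" "y \<notin> b ` {..<k}" "sum_free (insert y (b ` {..<k}))"
    and fresh: "bit x M \<or> bit y N"
  shows "paired_caps M' N' (Suc k) (a(k := x)) (b(k := y))"
proof -
  have le: "(2::nat) ^ M \<le> 2 ^ M'" "(2::nat) ^ N \<le> 2 ^ N'"
    using assms(2,3) by (simp_all add: power_increasing)
  have "\<exists>n. odd_at (a(k := x)) T n \<or> odd_at (b(k := y)) T n" if T: "T \<subseteq> {..<Suc k}" "T \<noteq> {}" for T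
  proof (cases "k \<in> T")
    case True
    have "T \<subseteq> {..k}" using T(1) by (simp add: lessThan_Suc_atMost)
    from fresh show ?thesis
    proof
      assume "bit x M"
      then have "odd_at (a(k := x)) T M"
        using \<open>T \<subseteq> {..k}\<close> True paired_capsD(2)[OF pc] by (intro odd_at_fresh) auto
      then show ?thesis by blast
    next
      assume "bit y N"
      then have "odd_at (b(k := y)) T N"
        using \<open>T \<subseteq> {..k}\<close> True paired_capsD(3)[OF pc] by (intro odd_at_fresh) auto
      then show ?thesis by blast
    qed
  next
    case False
    then have "T \<subseteq> {..<k}" using T by (auto simp: less_Suc_eq)
    then obtain n where "odd_at a T n \<or> odd_at b T n" using paired_capsD(7)[OF pc] T(2) by blast
    moreover have "odd_at (a(k := x)) T n = odd_at a T n" "odd_at (b(k := y)) T n = odd_at b T n"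
      using False by (auto intro!: odd_at_cong)
    ultimately show ?thesis by blast
  qed
  moreover have "\<forall>c<Suc k. odd ((a(k := x)) c) \<and> (a(k := x)) c < 2 ^ M' \<and> (b(k := y)) c < 2 ^ N'"
  proof (intro allI impI)
    fix c
    assume "c < Suc k"
    then consider "c < k" | "c = k" by linarith
    then show "odd ((a(k := x)) c) \<and> (a(k := x)) c < 2 ^ M' \<and> (b(k := y)) c < 2 ^ N'"
    proof cases
      case 1
      have "a c < 2 ^ M'" "b c < 2 ^ N'"
        using paired_capsD(2,3)[OF pc 1] le by linarith+
      then show ?thesis using 1 paired_capsD(1)[OF pc 1] by simp
    qed (use x y in simp)
  qed
  moreover have "inj_on (a(k := x)) {..<Suc k}" "inj_on (b(k := y)) {..<Suc k}"
    using paired_capsD(4,5)[OF pc] x(3) y(2) by (blast intro: inj_on_extend)+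
  ultimately show ?thesis
    using y(3) unfolding paired_caps_def image_extend by blast
qed

lemma exists_new_odd:
  assumes "k < 2 ^ (M - 1)" "1 \<le> M"
  shows "\<exists>x<(2::nat) ^ M. odd x \<and> x \<notin> a ` {..<k::nat}"
proof -
  have "card ((\<lambda>x. Suc (2 * x)) ` {..<2 ^ (M - 1)}) = 2 ^ (M - 1)"
    by (simp add: card_image inj_on_def)
  moreover have "card (a ` {..<k}) \<le> k" using card_image_le[of "{..<k}" a] by simp
  ultimately have "\<not> (\<lambda>x. Suc (2 * x)) ` {..<2 ^ (M - 1)} \<subseteq> a ` {..<k}"
    using assms(1) card_mono[of "a ` {..<k}" "(\<lambda>x. Suc (2 * x)) ` {..<2 ^ (M - 1)}"] by fastforce
  then obtain x where "x < 2 ^ (M - 1)" "Suc (2 * x) \<notin> a ` {..<k}" by auto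
  moreover have "2 ^ M = 2 * (2::nat) ^ (M - 1)"
    using assms(2) by (simp flip: power_Suc)
  ultimately show ?thesis by (intro exI[of _ "Suc (2 * x)"]) auto
qed

lemma paired_caps_Suc_right:
  assumes pc: "paired_caps M N k a b" and k: "k < 2 ^ (M - 1)" "1 \<le> M"
  shows "\<exists>x. paired_caps M (Suc N) (Suc k) (a(k := x)) (b(k := 2 ^ N))"
proof -
  obtain x where x: "x < 2 ^ M" "odd x" "x \<notin> a ` {..<k}" using exists_new_odd[OF k] by blast
  have b: "u < 2 ^ N" if "u \<in> b ` {..<k}" for u
    using paired_capsD(3)[OF pc] that by auto
  have "sum_free (insert (2 ^ N) (b ` {..<k}))"
  proof (intro sum_free_insert paired_capsD(6)[OF pc])
    show "2 ^ N \<notin> b ` {..<k}" using b[of "2 ^ N"] by blast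
    show "u \<oplus> v \<noteq> 2 ^ N" if "u \<in> b ` {..<k}" "v \<in> b ` {..<k}" for u v
      using xor_nat_less[OF b b, OF that] by simp
  qed simp
  then show ?thesis
    using paired_caps_extend[OF pc, of M "Suc N" x "2 ^ N"] x b by (auto simp: bit_exp_iff)
qed

text \<open>The first new index gets its fresh bit from \<open>2 ^ M\<close> on the \<open>b\<close>
  side, the second from \<open>2 ^ M + 1\<close> on the \<open>a\<close> side. The second also needs
  a \<open>b\<close>-vector that keeps the family sum-free.\<close>

lemma paired_caps_diagonal_step:
  assumes pc: "paired_caps M M k a b" and k: "k < 2 ^ (M - 1)" "1 \<le> M"
  shows "\<exists>a b. paired_caps (Suc M) (Suc M) (Suc (Suc k)) a b"
proof -
  obtain x where pc1: "paired_caps M (Suc M) (Suc k) (a(k := x)) (b(k := 2 ^ M))" (is "paired_caps _ _ _ ?a ?b")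
    using paired_caps_Suc_right[OF assms] by blast
  have b: "u < 2 ^ M" if "u \<in> b ` {..<k}" for u
    using paired_capsD(3)[OF pc] that by auto
  have a: "u < 2 ^ M" if "u \<in> ?a ` {..<Suc k}" for u
    using paired_capsD(2)[OF pc1] that by blast
  have "card (insert 0 (b ` {..<k})) \<le> Suc k"
    using card_image_le[of "{..<k}" b] by (simp add: card_insert_if)
  also have "Suc k < 2 ^ M"
  proof -
    have "2 ^ M = 2 * (2::nat) ^ (M - 1)" using k(2) by (simp flip: power_Suc)
    then show ?thesis using k by linarith
  qed
  \<comment> \<open>The vector will be \<open>2 ^ M \<oplus> z\<close>: \<open>z \<noteq> 0\<close>
    separates it from \<open>2 ^ M\<close>, and \<open>z\<close> outside the old family keeps it
    from being a sum of \<open>2 ^ M\<close> and an old member.\<close>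
  finally have "\<not> {..<2 ^ M} \<subseteq> insert 0 (b ` {..<k})"
    using card_mono[of "insert 0 (b ` {..<k})" "{..<2 ^ M}"] by fastforce
  then obtain z where z: "z < 2 ^ M" "z \<noteq> 0" "z \<notin> b ` {..<k}" by auto
  define y where "y = 2 ^ M \<oplus> z"
  have y: "y < 2 ^ Suc M" unfolding y_def using z by (intro xor_nat_less) auto
  have bity: "bit y M" using z not_bit_if_less[of z M] by (simp add: y_def bit_simps)
  have canc: "2 ^ M \<oplus> u = y \<longleftrightarrow> u = z" "u \<oplus> 2 ^ M = y \<longleftrightarrow> u = z" "y = 2 ^ M \<longleftrightarrow> z = 0" for u
    unfolding y_def by (auto simp: bit_eq_iff bit_simps)
  have small: "u \<noteq> y" if "u < 2 ^ M" for u using bity not_bit_if_less that by blast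
  have img: "?b ` {..<Suc k} = insert (2 ^ M) (b ` {..<k})" by (rule image_extend)
  have new: "y \<notin> ?b ` {..<Suc k}" unfolding img using small[OF b, of y] canc(3) z(2) by auto
  have "y \<noteq> 0" using small[of 0] by auto
  then have "sum_free (insert y (?b ` {..<Suc k}))"
    using new
  proof (intro sum_free_insert paired_capsD(6)[OF pc1])
    fix u v
    assume "u \<in> ?b ` {..<Suc k}" "v \<in> ?b ` {..<Suc k}"
    then consider "u = 2 ^ M" "v = 2 ^ M" | "u = 2 ^ M" "v \<in> b ` {..<k}" | "u \<in> b ` {..<k}" "v = 2 ^ M"
      | "u \<in> b ` {..<k}" "v \<in> b ` {..<k}"
      unfolding img by blast
    then show "u \<oplus> v \<noteq> y"
    proof cases
      case 1
      then show ?thesis using \<open>y \<noteq> 0\<close> by simp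
    next
      case 2
      then show ?thesis using canc(1)[of v] z(3) by auto
    next
      case 3
      then show ?thesis using canc(2)[of u] z(3) by auto
    next
      case 4
      then show ?thesis using small[OF xor_nat_less[OF b b]] by simp
    qed
  qed
  moreover have "(2::nat) ^ M + 1 < 2 ^ Suc M"
    using k(2) one_less_power[of "2::nat" M] by simp
  moreover have "(2 ^ M + 1) div 2 ^ M = (1 :: nat)"
    using k(2) one_less_power[of "2::nat" M] by (intro div_nat_eqI) simp_all
  then have "bit (2 ^ M + 1 :: nat) M" by (simp add: bit_iff_odd)
  moreover have "2 ^ M + 1 \<notin> ?a ` {..<Suc k}" using a by fastforce
  ultimately have "paired_caps (Suc M) (Suc M) (Suc (Suc k)) (?a(Suc k := 2 ^ M + 1)) (?b(Suc k := y))"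
    using k(2) y new by (intro paired_caps_extend[OF pc1]) auto
  then show ?thesis by blast
qed

text \<open>Once \<open>k\<close> has reached \<open>2 ^ (M - 1)\<close> no odd number is left, and
  only the bound on the \<open>b\<close> side grows; hence the minimum.\<close>

lemma paired_caps_add:
  assumes "\<exists>a b. paired_caps M N k a b" "k \<le> 2 ^ (M - 1)" "1 \<le> M"
  shows "\<exists>a b. paired_caps M (N + d) (min (k + d) (2 ^ (M - 1))) a b"
proof (induction d)
  case 0
  then show ?case using assms by simp
next
  case (Suc d)
  then obtain a b where pc: "paired_caps M (N + d) (min (k + d) (2 ^ (M - 1))) a b" by blast
  show ?case
  proof (cases "k + d < 2 ^ (M - 1)")
    case True
    then show ?thesis using paired_caps_Suc_right[OF pc] assms(3) by (auto simp: min_def)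
  next
    case False
    then have "min (k + Suc d) (2 ^ (M - 1)) = min (k + d) (2 ^ (M - 1))" by simp
    then show ?thesis using paired_caps_mono[OF pc, of "N + Suc d"] by auto
  qed
qed

text \<open>At \<open>M = 4\<close> both sides equal 8, which is why the diagonal induction starts
  at 5.\<close>

lemma double_less_power: "5 \<le> M \<Longrightarrow> 2 * M < 2 ^ (M - 1)"
proof (induction M rule: nat_induct_at_least)
  case (Suc n)
  have "2 ^ (Suc n - 1) = 2 * (2::nat) ^ (n - 1)" using Suc by (simp flip: power_Suc)
  then show ?case using Suc by simp
qed simp

lemma paired_caps_diagonal: "5 \<le> M \<Longrightarrow> \<exists>a b. paired_caps M M (2 * M) a b"
proof (induction M rule: nat_induct_at_least)
  case base
  then show ?case using paired_caps_5 by simp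
next
  case (Suc n)
  then show ?case using paired_caps_diagonal_step[of n "2 * n"] double_less_power[of n] by auto
qed

lemma paired_caps_exist:
  assumes "M \<le> N" "3 \<le> M" "k \<le> M + N" "k \<le> 2 ^ (M - 1)" "(k, M, N) \<notin> {(4, 3, 3), (8, 4, 4)}"
  shows "\<exists>a b. paired_caps M N k a b"
proof -
  obtain d where d: "N = M + d" using assms(1) le_Suc_ex by blast
  consider "M = 3" | "M = 4" | "5 \<le> M" using assms(2) by linarith
  \<comment> \<open>The base \<open>k0\<close> is 3, 7 or \<open>2 * M\<close>. For
    \<open>M = 3\<close> and \<open>M = 4\<close> the excluded triple settles \<open>d = 0\<close>,
    and for \<open>d > 0\<close> the value \<open>k0 + d\<close> already reaches
    \<open>2 ^ (M - 1)\<close>.\<close>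
  then obtain k0 where "\<exists>a b. paired_caps M M k0 a b" "k0 \<le> 2 ^ (M - 1)" "k \<le> min (k0 + d) (2 ^ (M - 1))"
  proof cases
    case 1
    then show ?thesis using that[of 3] paired_caps_3 assms d by (cases d) auto
  next
    case 2
    then show ?thesis using that[of 7] paired_caps_4 assms d by (cases d) auto
  next
    case 3
    then show ?thesis
      using that[of "2 * M"] paired_caps_diagonal double_less_power assms d by (simp add: less_imp_le)
  qed
  then show ?thesis
    using paired_caps_add[of M M k0 d] paired_caps_mono d assms(2) by (metis One_nat_def order.refl le_trans one_le_numeral)
qed

section \<open>Linear designs from paired caps\<close>

lemma odd_at_empty [simp]: "\<not> odd_at a {} n"
  by (simp add: odd_at_def)

lemma odd_at_insert [simp]:
  assumes "finite T" "c \<notin> T"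
  shows "odd_at a (insert c T) n \<longleftrightarrow> bit (a c) n \<noteq> odd_at a T n"
proof -
  have "{d \<in> insert c T. bit (a d) n} =
      (if bit (a c) n then insert c {d \<in> T. bit (a d) n} else {d \<in> T. bit (a d) n})"
    by auto
  then show ?thesis using assms by (simp add: odd_at_def)
qed

lemma zero_notin_sum_free: "sum_free B \<Longrightarrow> 0 \<notin> B"
  using sum_freeD[of B 0 0] by auto

text \<open>Sets of size 1, 2 and 3 have nonzero XOR by, respectively, absence of 0, injectivity and
  sum-freeness.\<close>

lemma odd_at_if_sum_free:
  assumes "inj_on b T" "sum_free (b ` T)" "T \<noteq> {}" "card T \<le> 3" "finite T"
  shows "\<exists>n. odd_at b T n"
proof -
  have diff: "\<exists>n. bit x n \<noteq> bit y n" if "x \<noteq> y" for x y :: nat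
    using that bit_eq_iff by blast
  have "card T \<noteq> 0" using assms(3,5) by simp
  then consider "card T = 1" | "card T = 2" | "card T = 3" using assms(4) by linarith
  then show ?thesis
  proof cases
    case 1
    then obtain c where T: "T = {c}" by (rule card_1_singletonE)
    then have ne: "b c \<noteq> 0" using zero_notin_sum_free[OF assms(2)] by auto
    from diff[OF ne] obtain n where "bit (b c) n \<noteq> bit (0 :: nat) n" ..
    then show ?thesis using T by (intro exI[of _ n]) simp
  next
    case 2
    then obtain c d where T: "T = {c, d}" "c \<noteq> d" by (auto simp: card_2_iff)
    then have ne: "b c \<noteq> b d" using assms(1) by auto
    from diff[OF ne] obtain n where "bit (b c) n \<noteq> bit (b d) n" ..
    then show ?thesis using T by (intro exI[of _ n]) simp
  next
    case 3
    then obtain c d e where T: "T = {c, d, e}" "c \<noteq> d" "c \<noteq> e" "d \<noteq> e" by (auto simp: card_3_iff)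
    then have ne: "b c \<oplus> b d \<noteq> b e" using sum_freeD[OF assms(2), of "b c" "b d"] by auto
    from diff[OF ne] obtain n where "bit (b c \<oplus> b d) n \<noteq> bit (b e) n" ..
    then show ?thesis using T by (intro exI[of _ n]) (auto simp: bit_xor_iff)
  qed
qed

lemma sum_free_if_odd: "(\<And>x. x \<in> B \<Longrightarrow> odd x) \<Longrightarrow> sum_free B"
  unfolding sum_free_def by (metis even_xor_iff)

text \<open>Left unreduced, since only its parity enters, through powers of -1 or
  \<open>mod 2\<close>.\<close>

definition dot :: "nat \<Rightarrow> nat \<Rightarrow> nat" where
  "dot x i = card {n. bit x n \<and> bit i n}"

lemma minus_one_power_dot_xor:
  "(- 1 :: int) ^ dot x (i \<oplus> 2 ^ n) = (if bit x n then - 1 else 1) * (- 1) ^ dot x i"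
proof (cases "bit x n")
  case True
  have "{m. bit x m} \<subseteq> {..<x}"
    using not_bit_if_less less_exp by (metis lessThan_iff linorder_not_less mem_Collect_eq order_le_less_trans subsetI)
  then have "finite {m. bit x m}" using finite_subset by blast
  then have fin: "finite {m. bit x m \<and> bit i m \<and> m \<noteq> n}" by (rule rev_finite_subset) auto
  have i: "{m. bit x m \<and> bit i m} =
      (if bit i n then insert n {m. bit x m \<and> bit i m \<and> m \<noteq> n} else {m. bit x m \<and> bit i m \<and> m \<noteq> n})"
    using True by auto
  have i': "{m. bit x m \<and> bit (i \<oplus> 2 ^ n) m} =
      (if bit i n then {m. bit x m \<and> bit i m \<and> m \<noteq> n} else insert n {m. bit x m \<and> bit i m \<and> m \<noteq> n})"
    using True by (auto simp: bit_simps)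
  show ?thesis unfolding dot_def i i' using True fin by simp
next
  case False
  then have "{m. bit x m \<and> bit (i \<oplus> 2 ^ n) m} = {m. bit x m \<and> bit i m}"
    by (auto simp: bit_simps)
  then show ?thesis using False by (simp add: dot_def)
qed

text \<open>Flipping bit \<open>n\<close> of \<open>i\<close> negates every term, and because
  \<open>n < M\<close> it permutes the range of summation.\<close>

lemma sum_character_eq_0:
  assumes "finite T" "\<And>c. c \<in> T \<Longrightarrow> a c < 2 ^ M" "odd_at a T n"
  shows "(\<Sum>i<2 ^ M. (- 1 :: int) ^ (\<Sum>c\<in>T. dot (a c) i)) = 0"
proof -
  let ?f = "\<lambda>i. (- 1 :: int) ^ (\<Sum>c\<in>T. dot (a c) i)"
  have "{c \<in> T. bit (a c) n} \<noteq> {}"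
    using assms(3) unfolding odd_at_def by (metis card.empty even_zero)
  then obtain c where c: "c \<in> T" "bit (a c) n" by blast
  have "n < M"
  proof (rule ccontr)
    assume "\<not> n < M"
    then have "(2::nat) ^ M \<le> 2 ^ n" by (simp add: power_increasing)
    with assms(2)[OF c(1)] have "a c < 2 ^ n" by linarith
    then show False using not_bit_if_less c(2) by blast
  qed
  then have lt: "i \<oplus> 2 ^ n < 2 ^ M" if "i < 2 ^ M" for i
    using that by (intro xor_nat_less) auto
  have "?f (i \<oplus> 2 ^ n) = - ?f i" for i
  proof -
    have "?f (i \<oplus> 2 ^ n) = (\<Prod>c\<in>T. if bit (a c) n then - 1 else 1) * ?f i"
      by (simp only: power_sum minus_one_power_dot_xor prod.distrib)
    also have "(\<Prod>c\<in>T. if bit (a c) n then - 1 else 1 :: int) = (- 1) ^ card {c \<in> T. bit (a c) n}"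
      using assms(1) by (simp add: prod.If_cases Int_def)
    also have "\<dots> = - 1" using assms(3) by (simp add: odd_at_def)
    finally show ?thesis by simp
  qed
  then have "(\<Sum>i<2 ^ M. ?f (i \<oplus> 2 ^ n)) = - (\<Sum>i<2 ^ M. ?f i)"
    by (simp only: sum_negf)
  moreover have "(\<Sum>i<2 ^ M. ?f (i \<oplus> 2 ^ n)) = (\<Sum>i<2 ^ M. ?f i)"
    by (rule sum.reindex_bij_witness[of _ "\<lambda>i. i \<oplus> 2 ^ n" "\<lambda>i. i \<oplus> 2 ^ n"])
      (use lt in \<open>auto simp: xor.assoc\<close>)
  ultimately show ?thesis by simp
qed

definition linear_design :: "nat \<Rightarrow> (nat \<Rightarrow> nat) \<Rightarrow> (nat \<Rightarrow> nat) \<Rightarrow> nat \<Rightarrow> nat \<Rightarrow> nat \<Rightarrow> nat" where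
  "linear_design k a b i j = (\<lambda>c\<in>{..<k}. (dot (a c) i + dot (b c) j) mod 2)"

lemma linear_design_in_vectors: "linear_design k a b i j \<in> vectors {..<k} 2"
  by (simp add: linear_design_def vectors_def)

lemma minus_one_power_mod_2: "(- 1 :: int) ^ (n mod 2) = (- 1) ^ n"
  by (cases "even n") (simp_all add: odd_iff_mod_2_eq_one)

lemma minus_one_power_linear_design:
  assumes "T \<subseteq> {..<k}"
  shows "(- 1 :: int) ^ (\<Sum>c\<in>T. linear_design k a b i j c) =
    (- 1) ^ (\<Sum>c\<in>T. dot (a c) i) * (- 1) ^ (\<Sum>c\<in>T. dot (b c) j)"
proof -
  have "(- 1 :: int) ^ (\<Sum>c\<in>T. linear_design k a b i j c) = (\<Prod>c\<in>T. (- 1) ^ (dot (a c) i + dot (b c) j))"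
    unfolding power_sum
  proof (rule prod.cong)
    fix c assume "c \<in> T"
    then have "c < k" using assms by auto
    then show "(- 1 :: int) ^ linear_design k a b i j c = (- 1) ^ (dot (a c) i + dot (b c) j)"
      by (simp add: linear_design_def minus_one_power_mod_2)
  qed simp
  then show ?thesis by (simp add: power_sum power_add prod.distrib)
qed

text \<open>The constant \<open>C\<close> absorbs the sign contributed by the fixed index, so that
  both rows and columns of the linear design are covered.\<close>

lemma orthogonal_array_if_sum_free:
  assumes "3 \<le> k" "inj_on b {..<k}" "sum_free (b ` {..<k})" "\<And>c. c < k \<Longrightarrow> b c < 2 ^ N"
    and A: "\<And>j. A j \<in> vectors {..<k} 2"
    and char: "\<And>T. T \<subseteq> {..<k} \<Longrightarrow> \<exists>C. \<forall>j. (- 1 :: int) ^ (\<Sum>c\<in>T. A j c) = C * (- 1) ^ (\<Sum>c\<in>T. dot (b c) j)"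
  shows "orthogonal_array (2 ^ N) k 2 3 A"
proof -
  have "card {j. j < 2 ^ N \<and> restrict (A j) S = v} * 2 ^ 3 = 2 ^ N"
    if S: "S \<subseteq> {..<k}" "card S = 3" and v: "v \<in> vectors S 2" for S v
  proof -
    have fin: "finite S" using S(1) finite_subset by blast
    have "card {j \<in> {..<2 ^ N}. restrict (A j) S = v} * 2 ^ card S = card {..<2 ^ N :: nat}"
    proof (rule uniform_if_character_sums[OF _ fin _ _ v])
      show "restrict (A j) S \<in> vectors S 2" for j
        using A S(1) by (rule restrict_in_vectors)
      show "(\<Sum>j<2 ^ N. (- 1 :: int) ^ (\<Sum>c\<in>T. A j c)) = 0" if T: "T \<subseteq> S" "T \<noteq> {}" for T
      proof -
        have T': "T \<subseteq> {..<k}" "finite T" "card T \<le> 3"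
          using T S fin finite_subset[of T S] card_mono[of S T] by auto
        obtain n where "odd_at b T n"
          using odd_at_if_sum_free[of b T] T' T(2) inj_on_subset[OF assms(2)]
            sum_free_subset[OF assms(3)] image_mono[OF T'(1), of b] by blast
        then have "(\<Sum>j<2 ^ N. (- 1 :: int) ^ (\<Sum>c\<in>T. dot (b c) j)) = 0"
          using sum_character_eq_0[of T b N n] T' assms(4) by auto
        moreover obtain C where "(- 1 :: int) ^ (\<Sum>c\<in>T. A j c) = C * (- 1) ^ (\<Sum>c\<in>T. dot (b c) j)" for j
          using char[OF T'(1)] by blast
        ultimately show ?thesis by (simp flip: sum_distrib_left)
      qed
    qed simp
    then show ?thesis using S(2) by simp
  qed
  then show ?thesis
    using assms(1) A unfolding orthogonal_array_def by simp
qed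

lemma row_column_design_if_paired_caps:
  assumes pc: "paired_caps M N k a b" and k: "3 \<le> k"
  shows "row_column_design k (2 ^ M) (2 ^ N) 2 3 (linear_design k a b)"
proof -
  let ?F = "linear_design k a b"
  note char = minus_one_power_linear_design[of _ k a b]
  have row: "orthogonal_array (2 ^ N) k 2 3 (\<lambda>j. ?F i j)" for i
    by (rule orthogonal_array_if_sum_free[OF k paired_capsD(5,6,3)[OF pc] linear_design_in_vectors])
      (use char in auto)
  have "sum_free (a ` {..<k})"
    using paired_capsD(1)[OF pc] by (intro sum_free_if_odd) auto
  then have col: "orthogonal_array (2 ^ M) k 2 3 (\<lambda>i. ?F i j)" for j
    by (intro orthogonal_array_if_sum_free[OF k paired_capsD(4)[OF pc] _ paired_capsD(2)[OF pc] linear_design_in_vectors])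
      (use char in \<open>auto simp: mult.commute\<close>)
  have "card {(i, j). i < 2 ^ M \<and> j < 2 ^ N \<and> ?F i j = v} * 2 ^ k = 2 ^ M * 2 ^ N"
    if v: "v \<in> vectors {..<k} 2" for v
  proof -
    let ?X = "{..<2 ^ M :: nat} \<times> {..<2 ^ N :: nat}"
    let ?h = "\<lambda>(i, j). ?F i j"
    have restr: "restrict (?F i j) {..<k} = ?F i j" for i j
      by (simp add: linear_design_def)
    have "card {x \<in> ?X. restrict (?h x) {..<k} = v} * 2 ^ card {..<k} = card ?X"
    proof (rule uniform_if_character_sums[OF _ _ _ _ v])
      show "restrict (?h x) {..<k} \<in> vectors {..<k} 2" for x
        by (cases x) (simp add: restr linear_design_in_vectors)
      fix T assume T: "T \<subseteq> {..<k}" "T \<noteq> {}"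
      let ?f = "\<lambda>i. (- 1 :: int) ^ (\<Sum>c\<in>T. dot (a c) i)"
      let ?g = "\<lambda>j. (- 1 :: int) ^ (\<Sum>c\<in>T. dot (b c) j)"
      have fin: "finite T" using T(1) finite_subset by blast
      obtain n where "odd_at a T n \<or> odd_at b T n" using paired_capsD(7)[OF pc T] by blast
      \<comment> \<open>The character sum over all cells is the product of these two sums, so one
        vanishing factor suffices.\<close>
      then have "(\<Sum>i<2 ^ M. ?f i) = 0 \<or> (\<Sum>j<2 ^ N. ?g j) = 0"
        using sum_character_eq_0[of T a M n] sum_character_eq_0[of T b N n] fin T(1) paired_capsD(2,3)[OF pc]
        by (auto simp: subset_iff)
      moreover have "(\<Sum>x\<in>?X. (- 1 :: int) ^ (\<Sum>c\<in>T. ?h x c)) = (\<Sum>(i, j)\<in>?X. ?f i * ?g j)"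
        by (intro sum.cong refl) (auto simp: char[OF T(1)])
      ultimately show "(\<Sum>x\<in>?X. (- 1 :: int) ^ (\<Sum>c\<in>T. ?h x c)) = 0"
        by (auto simp flip: sum_product sum.cartesian_product)
    qed simp_all
    moreover have "{x \<in> ?X. restrict (?h x) {..<k} = v} = {(i, j). i < 2 ^ M \<and> j < 2 ^ N \<and> ?F i j = v}"
      by (auto simp: restr)
    ultimately show ?thesis by simp
  qed
  then show ?thesis
    using k row col linear_design_in_vectors unfolding row_column_design_def by simp
qed

section \<open>Necessary conditions and the exceptional triples\<close>

lemma row_column_design_surj:
  assumes "row_column_design k m n q t F" "0 < m" "0 < n" "v \<in> vectors {..<k} q"
  obtains i j where "i < m" "j < n" "F i j = v"
proof -
  have "card {(i, j). i < m \<and> j < n \<and> F i j = v} * q ^ k = m * n"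
    using assms(1,4) by (simp add: row_column_design_def)
  then have "card {(i, j). i < m \<and> j < n \<and> F i j = v} \<noteq> 0"
    using assms(2,3) by (metis mult_eq_0_iff nat_less_le)
  then have "{(i, j). i < m \<and> j < n \<and> F i j = v} \<noteq> {}"
    by (metis card.empty)
  then show ?thesis using that by blast
qed

lemma no_rao_tight_square_design:
  assumes F: "row_column_design k n n 2 3 F" and n: "n = 2 * k" and k: "4 dvd k"
  shows False
proof -
  have oa: "orthogonal_array n k 2 3 (\<lambda>j. F i j)" "orthogonal_array n k 2 3 (\<lambda>j. F j i)" if "i < n" for i
    using F that by (simp_all add: row_column_design_def)
  have "0 < k" "0 < n" using F n by (simp_all add: row_column_design_def)
  let ?p = "\<lambda>v. (- 1 :: int) ^ (\<Sum>c<k. v c)"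
  \<comment> \<open>Two vectors of opposite parity; by balance both occur in the design.\<close>
  define v w where "v = (\<lambda>c\<in>{..<k}. 0 :: nat)" and "w = (\<lambda>c\<in>{..<k}. if c = 0 then 1 else 0 :: nat)"
  have "v \<in> vectors {..<k} 2" "w \<in> vectors {..<k} 2"
    by (auto simp: v_def w_def vectors_def)
  then obtain i j i' j' where ij: "i < n" "j < n" "F i j = v" "i' < n" "j' < n" "F i' j' = w"
    using row_column_design_surj[OF F \<open>0 < n\<close> \<open>0 < n\<close>] by metis
  \<comment> \<open>Moving along row \<open>i\<close> and then along column \<open>j'\<close> joins
    the two cells without changing parity.\<close>
  have "?p (F i j) = ?p (F i j')"
    using constant_parity_if_rao_tight[OF oa(1)] ij n k by blast
  also have "\<dots> = ?p (F i' j')"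
    using constant_parity_if_rao_tight[OF oa(2)] ij n k by blast
  finally show False
    using \<open>0 < k\<close> by (simp add: ij v_def w_def)
qed

theorem theorem10:
  fixes M N k :: nat
  assumes "1 \<le> M" and "M \<le> N" and "1 \<le> k"
  shows "(\<exists>F. row_column_design k (2 ^ M) (2 ^ N) 2 3 F) \<longleftrightarrow>
    3 \<le> k \<and> k \<le> M + N \<and> 3 \<le> M \<and> k \<le> 2 ^ (M - 1) \<and>
    (k, M, N) \<notin> {(4, 3, 3), (8, 4, 4)}"
    (is "?design \<longleftrightarrow> ?cond")
proof
  assume ?cond
  then obtain a b where "paired_caps M N k a b"
    using paired_caps_exist[of M N k] assms(2) by blast
  then show ?design
    using row_column_design_if_paired_caps \<open>?cond\<close> by blast
next
  assume ?design
  then obtain F where F: "row_column_design k (2 ^ M) (2 ^ N) 2 3 F" by blast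
  have k: "3 \<le> k" using F by (simp add: row_column_design_def)
  have col: "orthogonal_array (2 ^ M) k 2 3 (\<lambda>i. F i 0)"
    using F by (simp add: row_column_design_def)
  have zero: "(\<lambda>c\<in>S. 0) \<in> vectors S 2" for S
    by (simp add: vectors_def)
  \<comment> \<open>Counting the cells with the zero vector yields the divisibility behind
    \<open>k \<le> M + N\<close>; counting zero triples in one column likewise gives
    \<open>3 \<le> M\<close>.\<close>
  have "2 ^ (M + N) = 2 ^ k * card {(i, j). i < 2 ^ M \<and> j < 2 ^ N \<and> F i j = (\<lambda>c\<in>{..<k}. 0)}"
    using F zero by (simp add: row_column_design_def power_add mult.commute)
  then have "2 ^ k dvd (2 :: nat) ^ (M + N)" by (rule dvdI)
  then have kMN: "k \<le> M + N" by (rule power_dvd_imp_le) simp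
  have "2 ^ M = 2 ^ 3 * card {i. i < 2 ^ M \<and> restrict (F i 0) {..<3} = (\<lambda>c\<in>{..<3}. 0)}"
    using col zero k by (simp add: orthogonal_array_def mult.commute)
  then have "2 ^ 3 dvd (2 :: nat) ^ M" by (rule dvdI)
  then have M: "3 \<le> M" by (rule power_dvd_imp_le) simp
  have "2 * k \<le> 2 ^ M"
    using rao_bound[OF col] by simp
  also have "2 ^ M = 2 * (2 :: nat) ^ (M - 1)"
    using assms(1) by (simp flip: power_Suc)
  finally have "k \<le> 2 ^ (M - 1)" by simp
  moreover have "(k, M, N) \<notin> {(4, 3, 3), (8, 4, 4)}"
  proof -
    have "\<not> row_column_design 4 (2 ^ 3) (2 ^ 3) 2 3 F"
      by (rule notI, erule no_rao_tight_square_design) simp_all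
    moreover have "\<not> row_column_design 8 (2 ^ 4) (2 ^ 4) 2 3 F"
      by (rule notI, erule no_rao_tight_square_design) simp_all
    ultimately show ?thesis using F by blast
  qed
  ultimately show ?cond using k kMN M by blast
qed

end
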